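(* There exists an absolute constant $c>1$ with the property that $$K(f)\geq c\sqrt{d}$$ for every integer $d\geq 2$ and every rational function $f$ of degree $d$.
   Context: A rational function is a holomorphic map $f:\overline{\mathbf{C}}\to\overline{\mathbf{C}}$ of the Riemann sphere into itself. The Riemann sphere is equipped with the spherical metric with length element $ds=\frac{|dz|}{1+|z|^2}$. The norm of the derivative with respect to the spherical metric is $$\|f'\|(z)=|f'(z)|\,\frac{1+|z|^2}{1+|f(z)|^2},$$ extended by continuity to $z=\infty$ and to the poles of $f$. Define $K(f)=\max_{z\in\overline{\mathbf{C}}}\|f'\|(z)$. *)

theory Defs
  imports "HOL-Complex_Analysis.Complex_Analysis" "HOL-Computational_Algebra.Polynomial"
begin

(* The Riemann sphere: the type "complex option" with None as the point at infinity. *)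
type_synonym sphere = "complex option"

definition sphere_topology :: "sphere topology" where
  "sphere_topology = Alexandroff_compactification euclidean"

(* z \<mapsto> 1/z; it exchanges the two standard affine charts. *)
definition sphere_inv :: "sphere \<Rightarrow> sphere" where
  "sphere_inv x = (case x of None \<Rightarrow> Some 0
     | Some z \<Rightarrow> if z = 0 then None else Some (inverse z))"

(* Meaningful only where f (Some z) is finite. *)
definition affine_part :: "(sphere \<Rightarrow> sphere) \<Rightarrow> complex \<Rightarrow> complex" where
  "affine_part f z = the (f (Some z))"

(* Holomorphy in all four combinations of the charts z and 1/z on source and target.
   For continuous f each of the sets {z. g (Some z) \<noteq> None} is open. *)
definition rational_function :: "(sphere \<Rightarrow> sphere) \<Rightarrow> bool" where
  "rational_function f \<longleftrightarrow>
     continuous_map sphere_topology sphere_topology f \<and>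
     (\<forall>g \<in> {f, f \<circ> sphere_inv, sphere_inv \<circ> f, sphere_inv \<circ> f \<circ> sphere_inv}.
        affine_part g holomorphic_on {z. g (Some z) \<noteq> None})"

(* f = p/q in lowest terms with d = max (deg p) (deg q).  Coprimality excludes common zeros,
   so p/q takes the value infinity exactly at the zeros of q; the value of f at infinity is then
   determined by continuity. *)
definition has_degree :: "(sphere \<Rightarrow> sphere) \<Rightarrow> nat \<Rightarrow> bool" where
  "has_degree f d \<longleftrightarrow>
     (\<exists>p q :: complex poly. coprime p q \<and> d = max (degree p) (degree q) \<and>
        (\<forall>z. f (Some z) = (if poly q z = 0 then None else Some (poly p z / poly q z))))"

definition spherical_deriv_affine :: "(sphere \<Rightarrow> sphere) \<Rightarrow> complex \<Rightarrow> real" where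
  "spherical_deriv_affine f z =
     cmod (deriv (affine_part f) z) * ((1 + (cmod z)\<^sup>2) / (1 + (cmod (affine_part f z))\<^sup>2))"

(* Extension by continuity to infinity and to the poles.  For nonconstant rational f the poles
   are isolated, so these limits involve the affine formula only at regular points. *)
definition spherical_deriv :: "(sphere \<Rightarrow> sphere) \<Rightarrow> sphere \<Rightarrow> real" where
  "spherical_deriv f x = (case x of
       None \<Rightarrow> Lim at_infinity (spherical_deriv_affine f)
     | Some z \<Rightarrow> if f (Some z) = None then Lim (at z) (spherical_deriv_affine f)
                 else spherical_deriv_affine f z)"

(* The maximum of the set of values; Max is available only for finite sets. *)
definition K :: "(sphere \<Rightarrow> sphere) \<Rightarrow> real" where
  "K f = (GREATEST y. y \<in> range (spherical_deriv f))"

end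

theory Submission
  imports Defs
begin

text \<open>
  Write \<open>f = p / q\<close> in lowest terms. The weaker inequality \<open>K f \<ge> sqrt d\<close> has a proof by the
  maximum principle. The function
  \<open>h z = ln ((cmod (p z))\<^sup>2 + (cmod (q z))\<^sup>2) - d * ln (1 + (cmod z)\<^sup>2)\<close> extends smoothly to the sphere,
  and its spherical Laplacian is, up to a positive factor, the square of the spherical derivative of
  \<open>f\<close> minus \<open>d\<close>; this is nonnegative where \<open>h\<close> is minimal. The improvement by a constant factor
  comes from looking at a whole disc around such a minimum, of radius comparable to \<open>1 / sqrt d\<close>.

  Homogenizing \<open>p\<close> and \<open>q\<close> to binary forms makes the sphere compact in a concrete way: the minimum is
  taken on the unit sphere of \<open>\<complex>\<^sup>2\<close>, also when it lies at the point at infinity. After a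
  rotation of the source and one of the target, the minimum lies at 0 and \<open>f\<close> becomes a quotient
  \<open>A / B\<close> of entire functions with \<open>A 0 = 0\<close>, \<open>B 0 = 1\<close> and
  \<open>(1 + (cmod w)\<^sup>2)^d \<le> (cmod (A w))\<^sup>2 + (cmod (B w))\<^sup>2\<close>, while the bound \<open>M\<close> on the spherical derivative
  is preserved (\<open>normalized_pair\<close>).

  The bound \<open>M\<close> keeps \<open>A / B\<close> away from its poles on the disc of radius \<open>1 / M\<close>
  (\<open>proximity_bound\<close>), so \<open>g w = (A / B) (w / M)\<close> is holomorphic on the unit disc, with \<open>g 0 = 0\<close> and
  \<open>cmod (deriv g w) \<le> 1 + (cmod (g w))\<^sup>2\<close>. Write \<open>g w = w * k w\<close>. On a circle of radius \<open>r\<close> the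
  maximum principle, applied to the inverse square of the rescaled \<open>B\<close> times a correction by an
  exponential, turns the lower bound for \<open>A\<close> and \<open>B\<close> into an inequality that compares
  \<open>d / M\<^sup>2 - d * r\<^sup>2 / (2 * M\<^sup>4)\<close> with
  \<open>(cmod (k 0))\<^sup>2 + (cmod (k w - k 0))\<^sup>2 - r\<^sup>2 * cmod (k w)^4 / 2\<close> up to higher order
  (\<open>circle_inequality\<close>).

  Suppose now that \<open>M\<^sup>2\<close> is nearly \<open>d\<close>. Letting \<open>r\<close> tend to 0 shows that \<open>cmod (k 0)\<close> is nearly 1, and
  since \<open>cmod k\<close> is at most slightly larger than 1, the Schwarz-Pick inequality makes \<open>k\<close> nearly
  constant. At a small fixed radius the inequality then reads \<open>- r\<^sup>2 / 4 \<le> - r\<^sup>2 / 2\<close> up to small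
  errors, which is absurd. The term \<open>1 / 2\<close> is the curvature of the target sphere; the term \<open>1 / 4\<close> is
  the curvature of the source, which is \<open>1 / d\<close> times weaker after rescaling. So \<open>d \<ge> 2\<close> is exactly what
  separates the two (\<open>no_almost_isometric_disc\<close>).
\<close>

section \<open>Binary forms and rotated charts\<close>

text \<open>
  The homogenization of \<open>p\<close> with respect to the degree bound \<open>d\<close>, as a function on \<open>\<complex>\<^sup>2\<close>. A point of
  the sphere is a ratio \<open>x / y\<close>, and infinity is the ratio with \<open>y = 0\<close>.
\<close>
definition binary_form :: "nat \<Rightarrow> complex poly \<Rightarrow> complex \<Rightarrow> complex \<Rightarrow> complex" where
  "binary_form d p x y = (\<Sum>k\<le>d. coeff p k * x^k * y^(d-k))"

text \<open>
  For a unit vector \<open>(a, b)\<close> the substitution is the affine coordinate \<open>w\<close> after the rotation of the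
  sphere that takes 0 to \<open>a / b\<close>. Multiplying out the denominator keeps the function entire, also over
  the point at which \<open>w\<close> is sent to infinity.
\<close>
definition rotated_chart :: "nat \<Rightarrow> complex poly \<Rightarrow> complex \<Rightarrow> complex \<Rightarrow> complex \<Rightarrow> complex" where
  "rotated_chart d p a b w = binary_form d p (cnj b * w + a) (b - cnj a * w)"

text \<open>
  The spherical derivative of \<open>P / Q\<close> with denominators cleared. In this form it is symmetric in \<open>P\<close>
  and \<open>Q\<close>, and it is already the continuous extension to the poles.
\<close>
definition pair_deriv :: "(complex \<Rightarrow> complex) \<Rightarrow> (complex \<Rightarrow> complex) \<Rightarrow> complex \<Rightarrow> real" where
  "pair_deriv P Q z = cmod (deriv P z * Q z - P z * deriv Q z) * (1 + (cmod z)^2)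
     / ((cmod (P z))^2 + (cmod (Q z))^2)"

lemma binary_form_homogeneous: "binary_form d p (c * x) (c * y) = c^d * binary_form d p x y"
proof -
  have "coeff p k * (c * x)^k * (c * y)^(d - k) = c^d * (coeff p k * x^k * y^(d - k))" if "k \<le> d" for k
  proof -
    have "c^d = c^k * c^(d - k)" using that by (simp flip: power_add)
    then show ?thesis by (simp add: power_mult_distrib mult_ac)
  qed
  then show ?thesis unfolding binary_form_def sum_distrib_left by (intro sum.cong) auto
qed

lemma binary_form_affine: "degree p \<le> d \<Longrightarrow> binary_form d p x 1 = poly p x"
proof -
  assume "degree p \<le> d"
  then have "poly p x = (\<Sum>k\<le>d. coeff p k * x^k)"
    unfolding poly_altdef by (intro sum.mono_neutral_left) (auto simp: coeff_eq_0)
  then show ?thesis by (simp add: binary_form_def)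
qed

lemma binary_form_eq_poly:
  assumes "degree p \<le> d" "y \<noteq> 0"
  shows "binary_form d p x y = y^d * poly p (x / y)"
  using binary_form_homogeneous[of d p y "x / y" 1] binary_form_affine[OF assms(1), of "x / y"] assms(2) by simp

lemma binary_form_infinity: "binary_form d p x 0 = coeff p d * x^d"
proof -
  have "binary_form d p x 0 = (\<Sum>k\<in>{d}. coeff p k * x^k * 0^(d-k))"
    unfolding binary_form_def by (rule sum.mono_neutral_right) auto
  then show ?thesis by simp
qed

text \<open>
  For \<open>y \<noteq> 0\<close> this is coprimality. At infinity it holds because one of the two coefficients of degree
  \<open>d\<close> is a leading coefficient.
\<close>
lemma binary_forms_no_common_zero:
  assumes cop: "coprime p q" and d: "d = max (degree p) (degree q)" "d \<ge> 1"
    and nz: "x \<noteq> 0 \<or> y \<noteq> 0"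
  shows "(cmod (binary_form d p x y))^2 + (cmod (binary_form d q x y))^2 > 0"
proof -
  have "binary_form d p x y \<noteq> 0 \<or> binary_form d q x y \<noteq> 0"
  proof (cases "y = 0")
    case True
    have "coeff p d \<noteq> 0 \<or> coeff q d \<noteq> 0"
      using d leading_coeff_0_iff[of p] leading_coeff_0_iff[of q] by (cases "degree p \<ge> degree q") (auto simp: max_def)
    then show ?thesis using True nz by (auto simp: binary_form_infinity)
  next
    case False
    have "poly p (x / y) \<noteq> 0 \<or> poly q (x / y) \<noteq> 0"
      using coprime_poly_0[OF cop] by blast
    then show ?thesis using False d by (auto simp: binary_form_eq_poly)
  qed
  then show ?thesis by (auto simp: add_pos_nonneg add_nonneg_pos)
qed

lemma sum_squares_cmod_unitary:
  fixes a b w :: complex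
  assumes "(cmod a)^2 + (cmod b)^2 = 1"
  shows "(cmod (cnj b * w + a))^2 + (cmod (b - cnj a * w))^2 = 1 + (cmod w)^2"
proof -
  have "(cmod (cnj b * w + a))^2 + (cmod (b - cnj a * w))^2 = ((cmod a)^2 + (cmod b)^2) * (1 + (cmod w)^2)"
    unfolding cmod_power2 by (simp add: power2_eq_square algebra_simps)
  then show ?thesis using assms by simp
qed

lemma chart_argument_nonzero:
  assumes "(cmod a)^2 + (cmod b)^2 = 1"
  shows "cnj b * w + a \<noteq> 0 \<or> b - cnj a * w \<noteq> 0"
proof (rule ccontr)
  assume "\<not> ?thesis"
  then have zero: "cnj b * w + a = 0" "b - cnj a * w = 0" by blast+
  have "(1::real) + (cmod w)^2 = 0" using sum_squares_cmod_unitary[OF assms, of w] unfolding zero by simp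
  then show False by (smt (verit) zero_le_power2)
qed

lemma holomorphic_on_chart [holomorphic_intros]: "rotated_chart d p a b holomorphic_on S"
  unfolding rotated_chart_def binary_form_def by (intro holomorphic_intros)

text \<open>
  The spherical derivative is invariant under rotations of the source: the derivative of the factor
  \<open>(b - cnj a * w)^d\<close> cancels in the Wronskian, and the remaining powers of \<open>b - cnj a * w\<close> cancel by
  \<open>sum_squares_cmod_unitary\<close>.
\<close>
lemma pair_deriv_chart:
  assumes ab: "(cmod a)^2 + (cmod b)^2 = 1" and deg: "degree p \<le> d" "degree q \<le> d"
    and d: "d \<ge> 1" and y: "b - cnj a * w \<noteq> 0"
  shows "pair_deriv (rotated_chart d p a b) (rotated_chart d q a b) w
           = pair_deriv (poly p) (poly q) ((cnj b * w + a) / (b - cnj a * w))"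
proof -
  define x where "x = cnj b * w + a"
  define y where "y = b - cnj a * w"
  have y0: "y \<noteq> 0" using assms by (simp add: y_def)
  define z where "z = x / y"
  define G where "G = (cmod (poly p z))^2 + (cmod (poly q z))^2"
  have ab': "b * cnj b + a * cnj a = 1"
    using ab complex_norm_square[of a] complex_norm_square[of b]
    by (metis add.commute of_real_1 of_real_add)
  have xy: "cnj b * y + x * cnj a = 1" using ab' by (simp add: x_def y_def algebra_simps)
  have D: "deriv (rotated_chart d r a b) w = y^(d - 1) * (poly (pderiv r) z / y - of_nat d * cnj a * poly r z)"
    if deg: "degree r \<le> d" for r
  proof -
    have "((\<lambda>w. (b - cnj a * w)^d * poly r ((cnj b * w + a) / (b - cnj a * w))) has_field_derivative
        (of_nat d * (y^(d - 1) * (- cnj a)) * poly r z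
          + y^d * (poly (pderiv r) z * ((cnj b * y + x * cnj a) / (y * y))))) (at w)"
      unfolding x_def y_def z_def using assms
      by (auto intro!: derivative_eq_intros DERIV_chain2[OF poly_DERIV] simp: mult_ac)
    moreover have "of_nat d * (y^(d - 1) * (- cnj a)) * poly r z
          + y^d * (poly (pderiv r) z * ((cnj b * y + x * cnj a) / (y * y)))
        = y^(d - 1) * (poly (pderiv r) z / y - of_nat d * cnj a * poly r z)"
      unfolding xy using y0 d by (simp add: power_eq_if field_simps)
    ultimately have "((\<lambda>w. (b - cnj a * w)^d * poly r ((cnj b * w + a) / (b - cnj a * w))) has_field_derivative
        y^(d - 1) * (poly (pderiv r) z / y - of_nat d * cnj a * poly r z)) (at w)"
      by simp
    then have "(rotated_chart d r a b has_field_derivative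
        y^(d - 1) * (poly (pderiv r) z / y - of_nat d * cnj a * poly r z)) (at w)"
    proof (rule has_field_derivative_transform_within_open)
      show "open {w. b - cnj a * w \<noteq> 0}"
        by (intro open_Collect_neq continuous_intros)
      show "w \<in> {w. b - cnj a * w \<noteq> 0}" using assms by simp
    qed (use deg in \<open>auto simp: rotated_chart_def binary_form_eq_poly\<close>)
    then show ?thesis by (rule DERIV_imp_deriv)
  qed
  have val: "rotated_chart d r a b w = y^d * poly r z" if "degree r \<le> d" for r
    using binary_form_eq_poly[OF that y0, of x] by (simp add: rotated_chart_def x_def y_def z_def)
  have yd: "y^d = y^(d - 1) * y" using d by (simp add: power_eq_if)
  \<comment> \<open>The terms with \<open>of_nat d * cnj a\<close> are symmetric in \<open>p\<close> and \<open>q\<close> and drop out.\<close>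
  have W: "deriv (rotated_chart d p a b) w * rotated_chart d q a b w - rotated_chart d p a b w * deriv (rotated_chart d q a b) w
      = (y^(d - 1))^2 * (poly (pderiv p) z * poly q z - poly p z * poly (pderiv q) z)"
    unfolding D[OF deg(1)] D[OF deg(2)] val[OF deg(1)] val[OF deg(2)] yd
    using y0 by (simp add: field_simps power2_eq_square)
  have w: "1 + (cmod w)^2 = (cmod y)^2 * (1 + (cmod z)^2)"
  proof -
    have "1 + (cmod w)^2 = (cmod x)^2 + (cmod y)^2"
      unfolding x_def y_def by (rule sum_squares_cmod_unitary[OF ab, symmetric])
    then show ?thesis using y0 by (simp add: z_def norm_divide power_divide distrib_left)
  qed
  have G: "(cmod (rotated_chart d p a b w))^2 + (cmod (rotated_chart d q a b w))^2 = ((cmod y)^(d - 1))^2 * (cmod y)^2 * G"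
    unfolding val[OF deg(1)] val[OF deg(2)] yd G_def
    by (simp add: norm_mult norm_power power_mult_distrib distrib_left)
  have "pair_deriv (rotated_chart d p a b) (rotated_chart d q a b) w
      = (((cmod y)^(d - 1))^2 * cmod (poly (pderiv p) z * poly q z - poly p z * poly (pderiv q) z))
        * ((cmod y)^2 * (1 + (cmod z)^2)) / (((cmod y)^(d - 1))^2 * (cmod y)^2 * G)"
    unfolding pair_deriv_def W G w by (simp add: norm_mult norm_power)
  also have "\<dots> = cmod (poly (pderiv p) z * poly q z - poly p z * poly (pderiv q) z) * (1 + (cmod z)^2) / G"
    using y0 by simp
  also have "\<dots> = pair_deriv (poly p) (poly q) z"
    by (simp add: pair_deriv_def G_def DERIV_imp_deriv[OF poly_DERIV])
  finally show ?thesis by (simp add: z_def x_def y_def)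
qed

lemma continuous_on_pair_deriv:
  assumes "P holomorphic_on UNIV" "Q holomorphic_on UNIV"
    and "\<And>z. (cmod (P z))^2 + (cmod (Q z))^2 > 0"
  shows "continuous_on S (pair_deriv P Q)"
proof -
  have "continuous_on UNIV P" "continuous_on UNIV Q" "continuous_on UNIV (deriv P)" "continuous_on UNIV (deriv Q)"
    using assms(1,2) by (auto intro!: holomorphic_on_imp_continuous_on holomorphic_deriv)
  then have "continuous_on UNIV (pair_deriv P Q)"
    unfolding pair_deriv_def using assms(3) by (intro continuous_intros) (auto simp: less_le)
  then show ?thesis using continuous_on_subset by blast
qed

section \<open>The spherical derivative attains its maximum\<close>

text \<open>
  Both limits in the definition of the spherical derivative exist because they are limits of a
  continuous function: near a pole, of the formula with cleared denominators; near infinity, of the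
  same formula in the chart \<open>z = - 1 / w\<close>, which is the chart for \<open>(a, b) = (1, 0)\<close>.
\<close>
lemma spherical_deriv_eq:
  assumes cop: "coprime p q" and d: "d = max (degree p) (degree q)" "d \<ge> 1"
    and f: "\<And>z. f (Some z) = (if poly q z = 0 then None else Some (poly p z / poly q z))"
  shows "spherical_deriv f (Some z) = pair_deriv (poly p) (poly q) z"
    and "spherical_deriv f None = pair_deriv (rotated_chart d p 1 0) (rotated_chart d q 1 0) 0"
proof -
  have q0: "q \<noteq> 0"
  proof
    assume "q = 0"
    then have "is_unit p" using cop by simp
    moreover have "p \<noteq> 0" using d \<open>q = 0\<close> by auto
    ultimately show False using d \<open>q = 0\<close> by (simp add: is_unit_iff_degree)
  qed
  have G: "(cmod (poly p z))^2 + (cmod (poly q z))^2 > 0" for z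
    using binary_forms_no_common_zero[OF cop d, of z 1] d by (simp add: binary_form_affine)
  have regular: "spherical_deriv_affine f z = pair_deriv (poly p) (poly q) z" if z: "poly q z \<noteq> 0" for z
  proof -
    have "((\<lambda>z. poly p z / poly q z) has_field_derivative
        (poly (pderiv p) z * poly q z - poly p z * poly (pderiv q) z) / (poly q z * poly q z)) (at z)"
      using z by (intro DERIV_divide poly_DERIV)
    then have "(affine_part f has_field_derivative
        (poly (pderiv p) z * poly q z - poly p z * poly (pderiv q) z) / (poly q z * poly q z)) (at z)"
    proof (rule has_field_derivative_transform_within_open)
      show "open {z. poly q z \<noteq> 0}" by (intro open_Collect_neq continuous_intros)
    qed (use z in \<open>auto simp: affine_part_def f\<close>)
    then have D: "deriv (affine_part f) z
        = (poly (pderiv p) z * poly q z - poly p z * poly (pderiv q) z) / (poly q z * poly q z)"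
      by (rule DERIV_imp_deriv)
    have A: "affine_part f z = poly p z / poly q z" using z by (simp add: affine_part_def f)
    have 1: "1 + (cmod (poly p z / poly q z))^2 = ((cmod (poly p z))^2 + (cmod (poly q z))^2) / (cmod (poly q z))^2"
      using z by (simp add: norm_divide power_divide field_simps)
    show ?thesis
      unfolding spherical_deriv_affine_def D A 1 pair_deriv_def DERIV_imp_deriv[OF poly_DERIV]
      using z by (simp add: norm_divide norm_mult power2_eq_square)
  qed
  have nopole: "eventually (\<lambda>z. poly q z \<noteq> 0) (at z)" for z
    using poly_roots_finite[OF q0] islimpt_finite by (fastforce simp: islimpt_iff_eventually)
  have cont: "(pair_deriv (poly p) (poly q) \<longlongrightarrow> pair_deriv (poly p) (poly q) z) (at z)" for z
  proof -
    have "continuous_on UNIV (pair_deriv (poly p) (poly q))"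
      by (intro continuous_on_pair_deriv holomorphic_intros G)
    then show ?thesis by (simp add: continuous_on_def)
  qed
  show "spherical_deriv f (Some z) = pair_deriv (poly p) (poly q) z"
  proof (cases "poly q z = 0")
    case True
    have "(spherical_deriv_affine f \<longlongrightarrow> pair_deriv (poly p) (poly q) z) (at z)"
      using cont by (rule Lim_transform_eventually) (use nopole[of z] in eventually_elim, simp add: regular)
    then show ?thesis using True by (simp add: spherical_deriv_def f tendsto_Lim)
  next
    case False
    then show ?thesis by (simp add: spherical_deriv_def f regular)
  qed
  define C where "C = pair_deriv (rotated_chart d p 1 0) (rotated_chart d q 1 0)"
  have "continuous_on UNIV C"
    unfolding C_def
    by (rule continuous_on_pair_deriv)
       (use binary_forms_no_common_zero[OF cop d] in \<open>auto simp: rotated_chart_def intro!: holomorphic_intros\<close>)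
  then have C0: "(C \<longlongrightarrow> C 0) (at 0)" by (simp add: continuous_on_def)
  have "((\<lambda>z::complex. - inverse z) \<longlongrightarrow> 0) at_infinity"
    using tendsto_minus[OF tendsto_inverse_0] by simp
  moreover have "eventually (\<lambda>z::complex. - inverse z \<noteq> 0) at_infinity"
    using eventually_not_equal_at_infinity[of 0] by eventually_elim simp
  ultimately have "filterlim (\<lambda>z::complex. - inverse z) (at 0) at_infinity"
    by (simp add: filterlim_at)
  then have "((\<lambda>z. C (- inverse z)) \<longlongrightarrow> C 0) at_infinity"
    by (rule filterlim_compose[OF C0])
  moreover have "eventually (\<lambda>z. C (- inverse z) = spherical_deriv_affine f z) at_infinity"
  proof -
    have "eventually (\<lambda>z. poly q z \<noteq> 0) at_infinity"
    proof -
      obtain B where B: "\<And>z. poly q z = 0 \<Longrightarrow> cmod z \<le> B"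
        using finite_imp_bounded[OF poly_roots_finite[OF q0]] by (auto simp: bounded_iff)
      then show ?thesis
        unfolding eventually_at_infinity by (intro exI[of _ "B + 1"]) force
    qed
    then show ?thesis
      using eventually_not_equal_at_infinity[of "0::complex"]
    proof eventually_elim
      case (elim z)
      have "C (- inverse z) = pair_deriv (poly p) (poly q) ((cnj 0 * (- inverse z) + 1) / (0 - cnj 1 * (- inverse z)))"
        unfolding C_def by (rule pair_deriv_chart) (use d elim in auto)
      then show ?case using elim by (simp add: regular divide_inverse)
    qed
  qed
  ultimately have "(spherical_deriv_affine f \<longlongrightarrow> C 0) at_infinity"
    by (rule Lim_transform_eventually)
  then show "spherical_deriv f None = pair_deriv (rotated_chart d p 1 0) (rotated_chart d q 1 0) 0"
    by (simp add: spherical_deriv_def C_def tendsto_Lim[OF trivial_limit_at_infinity])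
qed

text \<open>
  A greatest value has to exist before the operator \<open>GREATEST\<close> says anything. It exists because the
  closed unit discs in the two charts \<open>z\<close> and \<open>- 1 / z\<close> cover the sphere and are compact.
\<close>
lemma spherical_deriv_le_K:
  assumes cop: "coprime p q" and d: "d = max (degree p) (degree q)" "d \<ge> 1"
    and f: "\<And>z. f (Some z) = (if poly q z = 0 then None else Some (poly p z / poly q z))"
  shows "spherical_deriv f x \<le> K f"
proof -
  note eqs = spherical_deriv_eq[OF cop d f]
  define C where "C = pair_deriv (rotated_chart d p 1 0) (rotated_chart d q 1 0)"
  define D where "D = pair_deriv (poly p) (poly q)"
  have "continuous_on (cball 0 1) C"
    unfolding C_def
    by (rule continuous_on_pair_deriv)
       (use binary_forms_no_common_zero[OF cop d] in \<open>auto simp: rotated_chart_def intro!: holomorphic_intros\<close>)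
  then obtain u where "\<forall>w\<in>cball 0 1. C w \<le> C u"
    using continuous_attains_sup[of "cball 0 1" C] by auto
  then have u: "C w \<le> C u" if "cmod w \<le> 1" for w using that by simp
  have "(cmod (poly p z))^2 + (cmod (poly q z))^2 > 0" for z
    using binary_forms_no_common_zero[OF cop d, of z 1] d by (simp add: binary_form_affine)
  then have "continuous_on (cball 0 1) D"
    unfolding D_def by (intro continuous_on_pair_deriv holomorphic_intros)
  then obtain v where "\<forall>z\<in>cball 0 1. D z \<le> D v"
    using continuous_attains_sup[of "cball 0 1" D] by auto
  then have v: "D z \<le> D v" if "cmod z \<le> 1" for z using that by simp
  have CD: "C w = D (- inverse w)" if "w \<noteq> 0" for w
  proof -
    have "C w = D ((cnj 0 * w + 1) / (0 - cnj 1 * w))"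
      unfolding C_def D_def by (rule pair_deriv_chart) (use d that in auto)
    then show ?thesis by (simp add: divide_inverse)
  qed
  have Cran: "C w \<in> range (spherical_deriv f)" for w
  proof (cases "w = 0")
    case True
    then show ?thesis using eqs(2) by (metis C_def rangeI)
  next
    case False
    then show ?thesis using eqs(1) CD by (metis D_def rangeI)
  qed
  have Dran: "D z \<in> range (spherical_deriv f)" for z
    using eqs(1) by (metis D_def rangeI)
  have le: "spherical_deriv f x \<le> max (C u) (D v)" for x
  proof (cases x)
    case None
    then show ?thesis using eqs(2) u[of 0] by (simp add: C_def le_max_iff_disj)
  next
    case (Some z)
    show ?thesis
    proof (cases "cmod z \<le> 1")
      case True
      then show ?thesis using eqs(1) v[of z] Some by (simp add: D_def le_max_iff_disj)
    next
      case False
      then have "z \<noteq> 0" by auto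
      then have "D z = C (- inverse z)" by (subst CD) auto
      also have "\<dots> \<le> C u" using False by (intro u) (simp add: norm_inverse inverse_le_1_iff)
      finally show ?thesis using eqs(1) Some by (simp add: D_def)
    qed
  qed
  have "K f = max (C u) (D v)"
    unfolding K_def using le Cran Dran by (intro Greatest_equality) (auto simp: max_def)
  then show ?thesis using le by simp
qed

section \<open>Normalization at a minimum\<close>

text \<open>
  A minimum on the unit sphere of \<open>\<complex>\<^sup>2\<close> gives a bound on all of \<open>\<complex>\<^sup>2\<close>, by homogeneity.
\<close>
lemma binary_forms_minimum_on_sphere:
  assumes cop: "coprime p q" and d: "d = max (degree p) (degree q)" "d \<ge> 1"
  obtains a b where "(cmod a)^2 + (cmod b)^2 = 1"
    "\<And>x y. ((cmod (binary_form d p a b))^2 + (cmod (binary_form d q a b))^2) * ((cmod x)^2 + (cmod y)^2)^d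
        \<le> (cmod (binary_form d p x y))^2 + (cmod (binary_form d q x y))^2"
proof -
  define g where "g v = (cmod (binary_form d p (fst v) (snd v)))^2 + (cmod (binary_form d q (fst v) (snd v)))^2"
    for v :: "complex \<times> complex"
  have cont: "continuous_on (sphere 0 1) g"
    unfolding g_def binary_form_def by (intro continuous_intros)
  have "sphere (0::complex \<times> complex) 1 \<noteq> {}" by simp
  then obtain v where v: "norm v = 1" and min: "\<And>u. norm u = 1 \<Longrightarrow> g v \<le> g u"
    using continuous_attains_inf[OF compact_sphere _ cont] by auto
  obtain a b where ab: "v = (a, b)" by (cases v)
  have hom: "g (of_real r * x, of_real r * y) = (r^d)^2 * g (x, y)" if "r > 0" for r x y
    using that by (simp add: g_def binary_form_homogeneous norm_mult norm_power power_mult_distrib distrib_left)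
  have "g (a, b) * ((cmod x)^2 + (cmod y)^2)^d \<le> g (x, y)" for x y
  proof (cases "x = 0 \<and> y = 0")
    case True
    then show ?thesis using d(2) by (simp add: g_def zero_power)
  next
    case False
    define r where "r = sqrt ((cmod x)^2 + (cmod y)^2)"
    have r2: "r^2 = (cmod x)^2 + (cmod y)^2" by (simp add: r_def)
    have r: "r > 0" using False by (auto simp: r_def add_pos_nonneg add_nonneg_pos)
    have "norm (x / of_real r, y / of_real r) = 1"
      using r r2 False by (simp add: norm_Pair norm_divide power_divide flip: add_divide_distrib)
    then have "(r^d)^2 * g (a, b) \<le> (r^d)^2 * g (x / of_real r, y / of_real r)"
      using min ab by (intro mult_left_mono) auto
    also have "\<dots> = g (x, y)" using hom[OF r, of "x / of_real r" "y / of_real r"] r by simp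
    also have "(r^d)^2 = ((cmod x)^2 + (cmod y)^2)^d" by (simp flip: r2 power_mult add: mult.commute)
    finally show ?thesis by (simp add: mult.commute)
  qed
  moreover have "(cmod a)^2 + (cmod b)^2 = 1" using v by (simp add: ab norm_Pair)
  ultimately show thesis using that[of a b] by (simp add: g_def)
qed

text \<open>
  The rotated chart can miss one finite point, the one over infinity; there the bound follows by
  continuity.
\<close>
lemma pair_deriv_chart_le:
  assumes ab: "(cmod a)^2 + (cmod b)^2 = 1" and cop: "coprime p q"
    and d: "d = max (degree p) (degree q)" "d \<ge> 1"
    and M: "\<And>z. pair_deriv (poly p) (poly q) z \<le> M"
  shows "pair_deriv (rotated_chart d p a b) (rotated_chart d q a b) w \<le> M"
proof (cases "b - cnj a * w = 0")
  case False
  then show ?thesis using pair_deriv_chart[OF ab _ _ d(2) False, of p q] M d by simp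
next
  case True
  have a: "a \<noteq> 0" using ab True by auto
  have "continuous_on UNIV (pair_deriv (rotated_chart d p a b) (rotated_chart d q a b))"
  proof (rule continuous_on_pair_deriv)
    show "(cmod (rotated_chart d p a b z))^2 + (cmod (rotated_chart d q a b z))^2 > 0" for z
      unfolding rotated_chart_def by (rule binary_forms_no_common_zero[OF cop d chart_argument_nonzero[OF ab]])
  qed (rule holomorphic_on_chart)+
  then have lim: "(pair_deriv (rotated_chart d p a b) (rotated_chart d q a b) \<longlongrightarrow> pair_deriv (rotated_chart d p a b) (rotated_chart d q a b) w) (at w)"
    by (simp add: continuous_on_def)
  have "eventually (\<lambda>u. u \<noteq> w) (at w)" by (rule eventually_neq_at_within)
  then have "eventually (\<lambda>u. pair_deriv (rotated_chart d p a b) (rotated_chart d q a b) u \<le> M) (at w)"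
  proof eventually_elim
    case (elim u)
    have "b - cnj a * u = cnj a * (w - u)" using True by (simp add: algebra_simps)
    then have "b - cnj a * u \<noteq> 0" using elim a by simp
    from pair_deriv_chart[OF ab _ _ d(2) this, of p q] show ?case using M d by simp
  qed
  then show ?thesis using tendsto_upperbound[OF lim] by simp
qed

text \<open>
  The source is rotated to put the minimum at 0. In the target the unitary matrix with rows
  proportional to \<open>(q0, - p0)\<close> and \<open>(cnj p0, cnj q0)\<close> is applied, which moves the value at 0 to 0 and
  changes neither the sum of squares nor the Wronskian beyond the common factor \<open>1 / m\<close>.
\<close>
lemma normalized_pair:
  assumes cop: "coprime p q" and d: "d = max (degree p) (degree q)" "d \<ge> 1"
    and M: "\<And>z. pair_deriv (poly p) (poly q) z \<le> M"
  obtains A B where "A holomorphic_on UNIV" "B holomorphic_on UNIV" "A 0 = 0" "B 0 = 1"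
    "\<And>w. (1 + (cmod w)^2)^d \<le> (cmod (A w))^2 + (cmod (B w))^2"
    "\<And>w. pair_deriv A B w \<le> M"
proof -
  obtain a b where ab: "(cmod a)^2 + (cmod b)^2 = 1" and min:
    "\<And>x y. ((cmod (binary_form d p a b))^2 + (cmod (binary_form d q a b))^2) * ((cmod x)^2 + (cmod y)^2)^d
        \<le> (cmod (binary_form d p x y))^2 + (cmod (binary_form d q x y))^2"
    using binary_forms_minimum_on_sphere[OF cop d] by metis
  define p0 where "p0 = binary_form d p a b"
  define q0 where "q0 = binary_form d q a b"
  define P where "P = rotated_chart d p a b"
  define Q where "Q = rotated_chart d q a b"
  define m where "m = (cmod p0)^2 + (cmod q0)^2"
  have "a \<noteq> 0 \<or> b \<noteq> 0" using ab by auto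
  then have m: "m > 0" unfolding m_def p0_def q0_def by (rule binary_forms_no_common_zero[OF cop d])
  have mc: "complex_of_real m = p0 * cnj p0 + q0 * cnj q0"
    unfolding m_def of_real_add complex_norm_square by simp
  have at0: "P 0 = p0" "Q 0 = q0" by (simp_all add: P_def Q_def rotated_chart_def p0_def q0_def)
  have hol: "P holomorphic_on UNIV" "Q holomorphic_on UNIV"
    unfolding P_def Q_def by (rule holomorphic_on_chart)+
  define A where "A w = (q0 * P w - p0 * Q w) / of_real m" for w
  define B where "B w = (cnj p0 * P w + cnj q0 * Q w) / of_real m" for w
  have holAB: "A holomorphic_on UNIV" "B holomorphic_on UNIV"
    unfolding A_def B_def using m by (auto intro!: holomorphic_intros hol)
  have sumsq: "(cmod (A w))^2 + (cmod (B w))^2 = ((cmod (P w))^2 + (cmod (Q w))^2) / m" for w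
  proof -
    have "(cmod (q0 * P w - p0 * Q w))^2 + (cmod (cnj p0 * P w + cnj q0 * Q w))^2
        = m * ((cmod (P w))^2 + (cmod (Q w))^2)"
      unfolding m_def cmod_power2 by (simp add: power2_eq_square algebra_simps)
    then show ?thesis
      using m by (simp add: A_def B_def norm_divide power_divide power2_eq_square flip: add_divide_distrib)
  qed
  have "pair_deriv A B w = pair_deriv P Q w" for w
  proof -
    have DP: "(P has_field_derivative deriv P w) (at w)" and DQ: "(Q has_field_derivative deriv Q w) (at w)"
      using hol by (auto intro!: holomorphic_derivI)
    have DA: "deriv A w = (q0 * deriv P w - p0 * deriv Q w) / of_real m"
      unfolding A_def by (rule DERIV_imp_deriv) (use m in \<open>auto intro!: derivative_eq_intros DP DQ\<close>)
    have DB: "deriv B w = (cnj p0 * deriv P w + cnj q0 * deriv Q w) / of_real m"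
      unfolding B_def by (rule DERIV_imp_deriv) (use m in \<open>auto intro!: derivative_eq_intros DP DQ\<close>)
    have "deriv A w * B w - A w * deriv B w
        = (p0 * cnj p0 + q0 * cnj q0) * (deriv P w * Q w - P w * deriv Q w) / (of_real m * of_real m)"
      unfolding DA DB unfolding A_def B_def using m by (simp add: field_simps)
    also have "\<dots> = (deriv P w * Q w - P w * deriv Q w) / of_real m"
      unfolding mc[symmetric] using m by simp
    finally show ?thesis
      unfolding pair_deriv_def sumsq using m by (simp add: norm_divide)
  qed
  moreover have "pair_deriv P Q w \<le> M" for w
    unfolding P_def Q_def by (rule pair_deriv_chart_le[OF ab cop d M])
  ultimately have up: "pair_deriv A B w \<le> M" for w by simp
  have "m * (1 + (cmod w)^2)^d \<le> (cmod (P w))^2 + (cmod (Q w))^2" for w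
    using min[of "cnj b * w + a" "b - cnj a * w"]
    unfolding sum_squares_cmod_unitary[OF ab] by (simp add: P_def Q_def rotated_chart_def m_def p0_def q0_def)
  then have low: "(1 + (cmod w)^2)^d \<le> (cmod (A w))^2 + (cmod (B w))^2" for w
    unfolding sumsq using m by (simp add: pos_le_divide_eq mult.commute)
  have "A 0 = 0" by (simp add: A_def at0)
  moreover have "B 0 = 1"
  proof -
    have "p0 * cnj p0 + q0 * cnj q0 \<noteq> 0" using m unfolding mc[symmetric] by simp
    then show ?thesis by (simp add: B_def at0 mc mult.commute)
  qed
  ultimately show thesis using that holAB low up by blast
qed

section \<open>Distance to the poles\<close>

lemma cmod_sq_has_real_derivative:
  fixes F :: "real \<Rightarrow> complex"
  assumes "(F has_vector_derivative F') (at t)"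
  shows "((\<lambda>t. (cmod (F t))^2) has_real_derivative 2 * Re (cnj (F t) * F')) (at t)"
proof -
  have "((\<lambda>t. F t \<bullet> F t) has_vector_derivative (F t \<bullet> F' + F' \<bullet> F t)) (at t)"
    by (rule bounded_bilinear.has_vector_derivative[OF bounded_bilinear_inner assms assms])
  then show ?thesis
    by (simp add: has_real_derivative_iff_has_vector_derivative dot_square_norm inner_commute)
       (simp add: inner_complex_def algebra_simps)
qed

text \<open>
  The quotient \<open>(cmod B)\<^sup>2 / ((cmod A)\<^sup>2 + (cmod B)\<^sup>2)\<close> is the squared cosine of the spherical distance
  from \<open>A / B\<close> to 0. It is smooth even at poles, it equals 1 at 0, and along a ray from 0 it changes with
  speed at most \<open>M\<close>, because the product of sine and cosine is at most \<open>1 / 2\<close>.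
\<close>
lemma proximity_bound:
  fixes A B :: "complex \<Rightarrow> complex"
  assumes holA: "A holomorphic_on UNIV" and holB: "B holomorphic_on UNIV"
    and A0: "A 0 = 0" and B0: "B 0 = 1"
    and nz: "\<And>z. (cmod (A z))^2 + (cmod (B z))^2 > 0"
    and up: "\<And>z. cmod (deriv A z * B z - A z * deriv B z) * (1 + (cmod z)^2)
              \<le> M * ((cmod (A z))^2 + (cmod (B z))^2)"
  shows "(1 - M * cmod z) * ((cmod (A z))^2 + (cmod (B z))^2) \<le> (cmod (B z))^2"
proof -
  define \<alpha> where "\<alpha> t = A (of_real t * z)" for t :: real
  define \<beta> where "\<beta> t = B (of_real t * z)" for t :: real
  define G where "G t = (cmod (\<alpha> t))^2 + (cmod (\<beta> t))^2" for t
  define X where "X t = (cmod (\<beta> t))^2 / G t" for t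
  have G: "G t > 0" for t using nz by (simp add: G_def \<alpha>_def \<beta>_def)
  have D: "((\<lambda>t. h (of_real t * z)) has_vector_derivative z * deriv h (of_real t * z)) (at t)"
    if "h holomorphic_on UNIV" for h :: "complex \<Rightarrow> complex" and t
  proof -
    have "(h has_field_derivative deriv h (of_real t * z)) (at (of_real t * z))"
      using that by (simp add: holomorphic_derivI)
    moreover have "((\<lambda>t. of_real t * z) has_vector_derivative z) (at t)"
      by (auto intro!: derivative_eq_intros)
    ultimately show ?thesis
      using field_vector_diff_chain_at[of "\<lambda>t. of_real t * z" z t h] by (simp add: o_def)
  qed
  have "\<exists>D. (X has_real_derivative D) (at t) \<and> \<bar>D\<bar> \<le> M * cmod z" for t
  proof -
    define a where "a = deriv A (of_real t * z)"
    define b where "b = deriv B (of_real t * z)"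
    have da: "((\<lambda>t. (cmod (\<alpha> t))^2) has_real_derivative 2 * Re (cnj (\<alpha> t) * (z * a))) (at t)"
      using cmod_sq_has_real_derivative[OF D[OF holA, of t]] by (simp add: \<alpha>_def a_def)
    have db: "((\<lambda>t. (cmod (\<beta> t))^2) has_real_derivative 2 * Re (cnj (\<beta> t) * (z * b))) (at t)"
      using cmod_sq_has_real_derivative[OF D[OF holB, of t]] by (simp add: \<beta>_def b_def)
    have dG: "(G has_real_derivative 2 * Re (cnj (\<alpha> t) * (z * a)) + 2 * Re (cnj (\<beta> t) * (z * b))) (at t)"
      unfolding G_def by (rule DERIV_add[OF da db])
    define D where "D = (2 * Re (cnj (\<beta> t) * (z * b)) * G t
        - (cmod (\<beta> t))^2 * (2 * Re (cnj (\<alpha> t) * (z * a)) + 2 * Re (cnj (\<beta> t) * (z * b)))) / (G t * G t)"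
    have "(X has_real_derivative D) (at t)"
      unfolding X_def D_def
      by (rule DERIV_divide[OF db dG]) (use G[of t] in simp)
    \<comment> \<open>The terms without the Wronskian cancel.\<close>
    moreover have "D = 2 * Re (cnj (\<alpha> t) * cnj (\<beta> t) * z * (b * \<alpha> t - \<beta> t * a)) / (G t * G t)"
      unfolding D_def G_def cmod_power2
      by (rule arg_cong2[of _ _ _ _ "(/)"]) (auto simp: algebra_simps power2_eq_square)
    moreover have "\<bar>2 * Re (cnj (\<alpha> t) * cnj (\<beta> t) * z * (b * \<alpha> t - \<beta> t * a))\<bar> \<le> M * cmod z * (G t * G t)"
    proof -
      have "\<bar>2 * Re (cnj (\<alpha> t) * cnj (\<beta> t) * z * (b * \<alpha> t - \<beta> t * a))\<bar>
          = 2 * \<bar>Re (cnj (\<alpha> t) * cnj (\<beta> t) * z * (b * \<alpha> t - \<beta> t * a))\<bar>"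
        by (simp only: abs_mult abs_numeral)
      also have "\<dots> \<le> 2 * cmod (cnj (\<alpha> t) * cnj (\<beta> t) * z * (b * \<alpha> t - \<beta> t * a))"
        by (intro mult_left_mono abs_Re_le_cmod) simp
      also have "\<dots> = (2 * cmod (\<alpha> t) * cmod (\<beta> t)) * cmod z * cmod (b * \<alpha> t - \<beta> t * a)"
        by (simp only: norm_mult complex_mod_cnj mult.assoc)
      also have "\<dots> \<le> G t * cmod z * (M * G t)"
      proof (intro mult_mono)
        show "2 * cmod (\<alpha> t) * cmod (\<beta> t) \<le> G t"
          unfolding G_def by (rule sum_squares_bound)
        have "cmod (b * \<alpha> t - \<beta> t * a) = cmod (a * \<beta> t - \<alpha> t * b)"
          by (metis mult.commute norm_minus_commute)
        also have "\<dots> \<le> cmod (a * \<beta> t - \<alpha> t * b) * (1 + (cmod (of_real t * z))^2)"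
          by (simp add: mult_le_cancel_left1)
        also have "\<dots> \<le> M * G t"
          using up[of "of_real t * z"] by (simp add: G_def \<alpha>_def \<beta>_def a_def b_def)
        finally show "cmod (b * \<alpha> t - \<beta> t * a) \<le> M * G t" .
      qed (use G[of t] in auto)
      finally show ?thesis by (simp add: mult_ac)
    qed
    ultimately show ?thesis using G[of t]
      by (intro exI[of _ D]) (simp add: divide_le_eq)
  qed
  then obtain D' where D': "\<And>t. (X has_real_derivative D' t) (at t)" "\<And>t. \<bar>D' t\<bar> \<le> M * cmod z"
    by metis
  obtain \<xi> where "X 1 - X 0 = (1 - 0) * D' \<xi>"
    using MVT2[of 0 1 X D'] D'(1) by auto
  moreover have "X 0 = 1" by (simp add: X_def G_def \<alpha>_def \<beta>_def A0 B0)
  ultimately have "X 1 \<ge> 1 - M * cmod z" using D'(2)[of \<xi>] by (simp add: abs_le_iff)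
  then have "(1 - M * cmod z) * G 1 \<le> (cmod (\<beta> 1))^2"
    using G[of 1] by (simp only: X_def pos_le_divide_eq)
  then show ?thesis by (simp add: G_def \<alpha>_def \<beta>_def)
qed

section \<open>Almost isometric discs\<close>

lemma ln_one_plus_ge_quadratic:
  fixes x :: real assumes "0 \<le> x" shows "x - x^2/2 \<le> ln (1 + x)"
proof -
  have "(\<lambda>x::real. ln (1 + x) - (x - x^2/2)) 0 \<le> (\<lambda>x. ln (1 + x) - (x - x^2/2)) x"
  proof (rule DERIV_nonneg_imp_nondecreasing[OF assms])
    fix t :: real assume t: "0 \<le> t" "t \<le> x"
    have "((\<lambda>x. ln (1 + x) - (x - x^2/2)) has_real_derivative (1/(1+t) - (1 - t))) (at t)"
      using t by (auto intro!: derivative_eq_intros)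
    moreover have "1/(1+t) - (1 - t) = t^2/(1+t)" using t by (simp add: field_simps power2_eq_square)
    ultimately show "\<exists>y. ((\<lambda>x. ln (1 + x) - (x - x^2/2)) has_real_derivative y) (at t) \<and> 0 \<le> y"
      using t by (intro exI[of _ "t^2/(1+t)"]) auto
  qed
  then show ?thesis by simp
qed

lemma ln_one_plus_le_cubic:
  fixes x :: real assumes "0 \<le> x" shows "ln (1 + x) \<le> x - x^2/2 + x^3/3"
proof -
  have "(\<lambda>x::real. (x - x^2/2 + x^3/3) - ln (1 + x)) 0 \<le> (\<lambda>x. (x - x^2/2 + x^3/3) - ln (1 + x)) x"
  proof (rule DERIV_nonneg_imp_nondecreasing[OF assms])
    fix t :: real assume t: "0 \<le> t" "t \<le> x"
    have "((\<lambda>x. (x - x^2/2 + x^3/3) - ln (1 + x)) has_real_derivative (1 - t + t^2 - 1/(1+t))) (at t)"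
      using t by (auto intro!: derivative_eq_intros)
    moreover have "1 - t + t^2 - 1/(1+t) = t^3/(1+t)"
      using t by (simp add: field_simps power2_eq_square power3_eq_cube)
    ultimately show "\<exists>y. ((\<lambda>x. (x - x^2/2 + x^3/3) - ln (1 + x)) has_real_derivative y) (at t) \<and> 0 \<le> y"
      using t by (intro exI[of _ "t^3/(1+t)"]) auto
  qed
  then show ?thesis by simp
qed

text \<open>
  The Schwarz lemma for \<open>k\<close> composed with the Moebius map of the disc of radius \<open>M\<close> that takes \<open>k 0\<close>
  to 0. If \<open>cmod (k 0)\<close> is close to the bound \<open>M\<close>, then \<open>k\<close> is almost constant near 0.
\<close>
lemma schwarz_pick_at_center:
  fixes k :: "complex \<Rightarrow> complex"
  assumes holk: "k holomorphic_on ball 0 R" and M: "\<And>z. cmod z < R \<Longrightarrow> cmod (k z) < M"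
    and z: "cmod z \<le> R/2" and R: "0 < R"
  shows "M * cmod (k z - k 0) \<le> 2 * (cmod z / R) * (M^2 - (cmod (k 0))^2)"
proof -
  define b where "b = k 0"
  define \<phi> where "\<phi> u = of_real M * (k (of_real R * u) - b) / (of_real (M^2) - cnj b * k (of_real R * u))" for u
  have Mpos: "0 < M" using M[of 0] R by (smt (verit) norm_ge_zero norm_zero)
  have b: "cmod b < M" using M[of 0] R by (simp add: b_def)
  have key: "(cmod (of_real M * (w - b)))^2 < (cmod (of_real (M^2) - cnj b * w))^2" if "cmod w < M" for w
  proof -
    have "(cmod (of_real (M^2) - cnj b * w))^2 - (cmod (of_real M * (w - b)))^2
        = (M^2 - (cmod b)^2) * (M^2 - (cmod w)^2)"
      unfolding cmod_power2 by (simp add: power2_eq_square algebra_simps)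
    moreover have "(M^2 - (cmod b)^2) * (M^2 - (cmod w)^2) > 0"
      using b that by (intro mult_pos_pos) (auto intro!: power_strict_mono)
    ultimately show ?thesis by linarith
  qed
  have in_ball: "cmod (of_real R * u) < R" if "cmod u < 1" for u :: complex
    using that R by (simp add: norm_mult)
  have nz: "of_real (M^2) - cnj b * k (of_real R * u) \<noteq> 0" if "cmod u < 1" for u
  proof
    assume "of_real (M^2) - cnj b * k (of_real R * u) = 0"
    then show False using key[OF M[OF in_ball[OF that]]] by simp
  qed
  have "(\<lambda>u. k (of_real R * u)) holomorphic_on ball 0 1"
    by (rule holomorphic_on_compose_gen[OF _ holk, unfolded o_def])
       (auto intro!: holomorphic_intros in_ball)
  then have hol\<phi>: "\<phi> holomorphic_on ball 0 1"
    unfolding \<phi>_def using nz by (intro holomorphic_intros) auto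
  have "cmod (\<phi> u) < 1" if "cmod u < 1" for u
  proof -
    have "cmod (of_real M * (k (of_real R * u) - b)) < cmod (of_real (M^2) - cnj b * k (of_real R * u))"
      using key[OF M[OF in_ball[OF that]]] by (rule power_less_imp_less_base) simp
    then show ?thesis by (simp add: \<phi>_def norm_divide divide_less_eq)
  qed
  moreover have "cmod (z / of_real R) < 1" using z R by (simp add: norm_divide)
  ultimately have "cmod (\<phi> (z / of_real R)) \<le> cmod (z / of_real R)"
    by (intro Schwarz_Lemma(1)[OF hol\<phi>]) (simp_all add: \<phi>_def b_def)
  moreover have "\<phi> (z / of_real R) = of_real M * (k z - b) / (of_real (M^2) - cnj b * k z)"
    using R by (simp add: \<phi>_def)
  moreover have "of_real (M^2) - cnj b * k z \<noteq> 0"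
    using nz[of "z / of_real R"] z R by (simp add: norm_divide)
  ultimately have "M * cmod (k z - b) \<le> cmod z / R * cmod (of_real (M^2) - cnj b * k z)"
    using Mpos R by (simp add: norm_mult norm_divide divide_le_eq)
  also have "\<dots> \<le> cmod z / R * ((M^2 - (cmod b)^2) + M * cmod (k z - b))"
  proof (rule mult_left_mono)
    have "of_real (M^2) - cnj b * k z = of_real (M^2 - (cmod b)^2) - cnj b * (k z - b)"
      unfolding of_real_diff complex_norm_square by (simp add: algebra_simps)
    also have "cmod \<dots> \<le> cmod (complex_of_real (M^2 - (cmod b)^2)) + cmod (cnj b * (k z - b))"
      by (rule norm_triangle_ineq4)
    also have "cmod (complex_of_real (M^2 - (cmod b)^2)) = M^2 - (cmod b)^2"
      unfolding norm_of_real using b by (simp add: power_mono)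
    also have "cmod (cnj b * (k z - b)) \<le> M * cmod (k z - b)"
      using b by (simp add: norm_mult mult_right_mono)
    finally show "cmod (of_real (M^2) - cnj b * k z) \<le> (M^2 - (cmod b)^2) + M * cmod (k z - b)" by simp
  qed (use R in simp)
  \<comment> \<open>Because \<open>cmod z \<le> R / 2\<close>, the last term can be absorbed into the left-hand side.\<close>
  also have "cmod z / R * (M * cmod (k z - b)) \<le> 1/2 * (M * cmod (k z - b))"
    using z R Mpos by (intro mult_right_mono) (auto simp: divide_le_eq)
  then have "cmod z / R * ((M^2 - (cmod b)^2) + M * cmod (k z - b))
      \<le> cmod z / R * (M^2 - (cmod b)^2) + 1/2 * (M * cmod (k z - b))"
    by (simp add: distrib_left)
  finally show ?thesis by (simp add: b_def)
qed

text \<open>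
  This replaces the mean value property on a circle. The harmonic function
  \<open>ln ((cmod \<beta>)\<^sup>2) + 2 * r\<^sup>2 * Re (cnj (k 0) * (k - k 0))\<close> vanishes at 0, so it cannot be positive on the
  whole circle; exponentiating avoids the choice of a logarithm of \<open>\<beta>\<close>.
\<close>
lemma exists_circle_point_small_modulus:
  fixes k \<beta> :: "complex \<Rightarrow> complex"
  assumes holk: "k holomorphic_on ball 0 1" and hol\<beta>: "\<beta> holomorphic_on ball 0 1"
    and nz: "\<And>w. cmod w < 1 \<Longrightarrow> \<beta> w \<noteq> 0" and \<beta>0: "\<beta> 0 = 1" and r: "0 < r" "r < 1"
  obtains w where "cmod w = r"
    "(cmod (\<beta> w))^2 \<le> exp (- 2 * r^2 * Re (cnj (k 0) * (k w - k 0)))"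
proof -
  define \<Theta> where "\<Theta> w = exp (of_real (- 2 * r^2) * (cnj (k 0) * (k w - k 0))) / (\<beta> w)^2" for w
  have hol: "\<Theta> holomorphic_on ball 0 1"
    unfolding \<Theta>_def using nz by (intro holomorphic_intros holk hol\<beta>) auto
  have sub: "cball 0 r \<subseteq> ball (0::complex) 1" using r by auto
  have cont: "continuous_on (cball 0 r) \<Theta>"
    using holomorphic_on_imp_continuous_on[OF hol] sub continuous_on_subset by blast
  have sph: "compact (sphere (0::complex) r)" "sphere (0::complex) r \<noteq> {}" using r by auto
  have csph: "continuous_on (sphere 0 r) (\<lambda>w. cmod (\<Theta> w))"
    by (intro continuous_on_norm continuous_on_subset[OF cont]) auto
  obtain w where w: "w \<in> sphere 0 r" and max: "\<And>v. v \<in> sphere 0 r \<Longrightarrow> cmod (\<Theta> v) \<le> cmod (\<Theta> w)"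
    using continuous_attains_sup[OF sph csph] by auto
  have "cmod (\<Theta> 0) \<le> cmod (\<Theta> w)"
  proof (rule maximum_modulus_frontier[where S = "cball 0 r" and f = \<Theta>])
    show "\<Theta> holomorphic_on interior (cball 0 r)"
      by (rule holomorphic_on_subset[OF hol]) (use r in auto)
    show "continuous_on (closure (cball 0 r)) \<Theta>" using cont by simp
    show "cmod (\<Theta> z) \<le> cmod (\<Theta> w)" if "z \<in> frontier (cball 0 r)" for z
      using that max by (simp add: frontier_cball)
  qed (use r in auto)
  moreover have "cmod (\<Theta> 0) = 1" by (simp add: \<Theta>_def \<beta>0)
  moreover have "cmod (\<Theta> w) = exp (- 2 * r^2 * Re (cnj (k 0) * (k w - k 0))) / (cmod (\<beta> w))^2"
    unfolding \<Theta>_def norm_divide norm_exp_eq_Re norm_power by simp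
  moreover have wr: "cmod w = r" using w by simp
  moreover have "\<beta> w \<noteq> 0" using nz wr r by simp
  ultimately have "(cmod (\<beta> w))^2 \<le> exp (- 2 * r^2 * Re (cnj (k 0) * (k w - k 0)))"
    by (simp add: le_divide_eq)
  then show thesis using that wr by blast
qed

text \<open>
  At the point found by the maximum principle the linear part of
  \<open>(cmod (k w))\<^sup>2 = (cmod (k 0))\<^sup>2 + 2 * Re (cnj (k 0) * (k w - k 0)) + (cmod (k w - k 0))\<^sup>2\<close> cancels
  against the bound for \<open>\<beta>\<close>. Only the square of \<open>k w - k 0\<close> survives, which is what makes the
  inequality sharp enough to detect terms of order \<open>r\<^sup>2\<close>.
\<close>
lemma circle_inequality:
  fixes k \<beta> :: "complex \<Rightarrow> complex" and \<kappa> :: real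
  assumes holk: "k holomorphic_on ball 0 1" and hol\<beta>: "\<beta> holomorphic_on ball 0 1"
    and nz: "\<And>w. cmod w < 1 \<Longrightarrow> \<beta> w \<noteq> 0" and \<beta>0: "\<beta> 0 = 1" and r: "0 < r" "r < 1"
    and \<kappa>: "\<kappa> > 0"
    and low: "\<And>w. cmod w < 1 \<Longrightarrow>
       (1 + (cmod w)^2 / \<kappa>)^d \<le> (cmod (\<beta> w))^2 * (1 + (cmod (w * k w))^2)"
  obtains w where "cmod w = r"
    "d / \<kappa> - d * r^2 / (2 * \<kappa>^2) \<le>
       (cmod (k 0))^2 + (cmod (k w - k 0))^2 - r^2 * cmod (k w)^4 / 2 + r^4 * cmod (k w)^6 / 3"
proof -
  obtain w where w: "cmod w = r"
    and le: "(cmod (\<beta> w))^2 \<le> exp (- 2 * r^2 * Re (cnj (k 0) * (k w - k 0)))"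
    using exists_circle_point_small_modulus[OF holk hol\<beta> nz \<beta>0 r] by blast
  define x where "x = r^2 * (cmod (k w))^2"
  define R where "R = Re (cnj (k 0) * (k w - k 0))"
  have x: "x \<ge> 0" by (simp add: x_def)
  have \<beta>: "(cmod (\<beta> w))^2 > 0" using nz[of w] w r by simp
  have ln\<beta>: "ln ((cmod (\<beta> w))^2) \<le> - 2 * r^2 * R"
    using le \<beta> by (subst ln_exp[symmetric], subst ln_le_cancel_iff) (simp_all add: R_def)
  have pos: "0 < 1 + r^2/\<kappa>" using \<kappa> by (simp add: add_pos_nonneg)
  have "d * (r^2/\<kappa> - (r^2/\<kappa>)^2/2) \<le> d * ln (1 + r^2/\<kappa>)"
    using \<kappa> by (intro mult_left_mono ln_one_plus_ge_quadratic) auto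
  also have "\<dots> = ln ((1 + r^2/\<kappa>)^d)" using pos by (simp add: ln_realpow)
  also have "\<dots> \<le> ln ((cmod (\<beta> w))^2 * (1 + x))"
  proof -
    have "(1 + r^2/\<kappa>)^d \<le> (cmod (\<beta> w))^2 * (1 + x)"
      using low[of w] w r by (simp add: x_def norm_mult power_mult_distrib)
    moreover have "0 < (1 + r^2/\<kappa>)^d" using pos by simp
    ultimately show ?thesis by (subst ln_le_cancel_iff) (auto intro: less_le_trans)
  qed
  also have "\<dots> = ln ((cmod (\<beta> w))^2) + ln (1 + x)"
    using \<beta> x by (simp add: ln_mult)
  also have "\<dots> \<le> - 2 * r^2 * R + (x - x^2/2 + x^3/3)"
    using ln\<beta> ln_one_plus_le_cubic[OF x] by linarith
  also have "\<dots> = r^2 * ((cmod (k 0))^2 + (cmod (k w - k 0))^2) - x^2/2 + x^3/3"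
  proof -
    have "(cmod (k w))^2 = (cmod (k 0))^2 + 2 * R + (cmod (k w - k 0))^2"
      unfolding R_def cmod_power2 by (simp add: power2_eq_square algebra_simps)
    then have "x = r^2 * ((cmod (k 0))^2 + (cmod (k w - k 0))^2) + 2 * r^2 * R"
      unfolding x_def by (simp add: distrib_left)
    then show ?thesis by linarith
  qed
  also have "\<dots> = r^2 * ((cmod (k 0))^2 + (cmod (k w - k 0))^2
      - r^2 * cmod (k w)^4 / 2 + r^4 * cmod (k w)^6 / 3)"
  proof -
    have "x^2 = r^2 * (r^2 * cmod (k w)^4)" "x^3 = r^2 * (r^4 * cmod (k w)^6)"
      unfolding x_def by (simp_all add: eval_nat_numeral mult_ac)
    then show ?thesis by (simp add: right_diff_distrib distrib_left)
  qed
  also have "d * (r^2/\<kappa> - (r^2/\<kappa>)^2/2) = r^2 * (d / \<kappa> - d * r^2 / (2 * \<kappa>^2))"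
    using \<kappa> by (simp add: field_simps power2_eq_square)
  finally have "r^2 * (d / \<kappa> - d * r^2 / (2 * \<kappa>^2)) \<le> r^2 * ((cmod (k 0))^2 + (cmod (k w - k 0))^2
      - r^2 * cmod (k w)^4 / 2 + r^4 * cmod (k w)^6 / 3)" .
  then have "d / \<kappa> - d * r^2 / (2 * \<kappa>^2) \<le> (cmod (k 0))^2 + (cmod (k w - k 0))^2
      - r^2 * cmod (k w)^4 / 2 + r^4 * cmod (k w)^6 / 3"
    by (rule mult_left_le_imp_le) (use r in simp)
  with w show thesis by (rule that)
qed

text \<open>
  The limit of the circle inequality as the radius tends to 0.
\<close>
lemma center_derivative_lower_bound:
  fixes k \<beta> :: "complex \<Rightarrow> complex" and \<kappa> :: real
  assumes holk: "k holomorphic_on ball 0 1" and hol\<beta>: "\<beta> holomorphic_on ball 0 1"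
    and nz: "\<And>w. cmod w < 1 \<Longrightarrow> \<beta> w \<noteq> 0" and \<beta>0: "\<beta> 0 = 1"
    and \<kappa>: "\<kappa> > 0"
    and low: "\<And>w. cmod w < 1 \<Longrightarrow>
       (1 + (cmod w)^2 / \<kappa>)^d \<le> (cmod (\<beta> w))^2 * (1 + (cmod (w * k w))^2)"
  shows "d / \<kappa> \<le> (cmod (k 0))^2"
proof -
  define P where "P r w \<longleftrightarrow> cmod w = r \<and> d / \<kappa> - d * r^2 / (2 * \<kappa>^2) \<le>
       (cmod (k 0))^2 + (cmod (k w - k 0))^2 - r^2 * cmod (k w)^4 / 2 + r^4 * cmod (k w)^6 / 3" for r :: real and w
  have "\<exists>w. P r w" if "r \<in> {0<..<1}" for r
  proof (rule circle_inequality[OF holk hol\<beta> nz \<beta>0 _ _ \<kappa> low, of r])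
  qed (use that in \<open>auto simp: P_def\<close>)
  then obtain W where W: "\<And>r. r \<in> {0<..<1} \<Longrightarrow> P r (W r)" by metis
  have ev: "eventually (\<lambda>r. P r (W r)) (at_right (0::real))"
    by (rule eventually_at_rightI[of 0 1]) (use W in auto)
  have W0: "(W \<longlongrightarrow> 0) (at_right 0)"
  proof (rule tendsto_norm_zero_cancel)
    have "((\<lambda>r::real. r) \<longlongrightarrow> 0) (at_right 0)" by (rule tendsto_ident_at)
    then show "((\<lambda>r. cmod (W r)) \<longlongrightarrow> 0) (at_right 0)"
      by (rule Lim_transform_eventually) (use ev in eventually_elim, simp add: P_def)
  qed
  have "isCont k 0"
    using holomorphic_on_imp_continuous_on[OF holk] by (simp add: continuous_on_eq_continuous_at)
  then have kW: "((\<lambda>r. k (W r)) \<longlongrightarrow> k 0) (at_right 0)"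
    using W0 isCont_tendsto_compose by blast
  have lim_left: "((\<lambda>r::real. d / \<kappa> - d * r^2 / (2 * \<kappa>^2)) \<longlongrightarrow> d / \<kappa>) (at_right 0)"
    using \<kappa> by (auto intro!: tendsto_eq_intros)
  have "((\<lambda>r. (cmod (k 0))^2 + (cmod (k (W r) - k 0))^2 - r^2 * cmod (k (W r))^4 / 2
        + r^4 * cmod (k (W r))^6 / 3)
      \<longlongrightarrow> (cmod (k 0))^2 + (cmod (k 0 - k 0))^2 - 0^2 * cmod (k 0)^4 / 2 + 0^4 * cmod (k 0)^6 / 3) (at_right 0)"
    by (intro tendsto_intros tendsto_ident_at kW) auto
  then have lim_right: "((\<lambda>r. (cmod (k 0))^2 + (cmod (k (W r) - k 0))^2 - r^2 * cmod (k (W r))^4 / 2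
        + r^4 * cmod (k (W r))^6 / 3) \<longlongrightarrow> (cmod (k 0))^2) (at_right 0)"
    by simp
  show ?thesis
    by (rule tendsto_le[OF trivial_limit_at_right_real lim_right lim_left])
       (use ev in eventually_elim, simp add: P_def)
qed

text \<open>
  Three scales are involved. On the disc of radius \<open>R = 1 / 200\<close> the derivative bound gives
  \<open>cmod k \<le> 1 + 4 * R\<^sup>2\<close>; on the circle of radius \<open>\<rho> = R / 2\<close> the Schwarz-Pick inequality then gives
  \<open>cmod (k w - k 0) \<le> \<rho> / 9\<close>, so that \<open>(cmod (k w - k 0))\<^sup>2\<close> is negligible against \<open>\<rho>\<^sup>2 / 4\<close>. Finally
  \<open>\<epsilon> = \<rho>\<^sup>2 / 100\<close> makes the defect in \<open>cmod (k 0)\<close> negligible against \<open>\<rho>\<^sup>2\<close> as well.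
\<close>
lemma no_almost_isometric_disc:
  fixes g \<beta> :: "complex \<Rightarrow> complex" and \<epsilon> :: real and d :: nat
  assumes holg: "g holomorphic_on ball 0 1" and hol\<beta>: "\<beta> holomorphic_on ball 0 1"
    and nz: "\<And>w. cmod w < 1 \<Longrightarrow> \<beta> w \<noteq> 0" and \<beta>0: "\<beta> 0 = 1" and g0: "g 0 = 0"
    and dg: "\<And>w. cmod w < 1 \<Longrightarrow> cmod (deriv g w) \<le> 1 + (cmod (g w))^2"
    and prox: "\<And>w. cmod w < 1 \<Longrightarrow> (1 - cmod w) * (1 + (cmod (g w))^2) \<le> 1"
    and d: "d \<ge> 2" and \<epsilon>: "\<epsilon> = 1 / 16000000"
    and low: "\<And>w. cmod w < 1 \<Longrightarrow>
       (1 + (cmod w)^2 / ((1 + \<epsilon>) * d))^d \<le> (cmod (\<beta> w))^2 * (1 + (cmod (g w))^2)"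
  shows False
proof -
  define R :: real where "R = 1 / 200"
  define \<rho> :: real where "\<rho> = 1 / 400"
  define M :: real where "M = 1 + 5 * R^2"
  define \<kappa> where "\<kappa> = (1 + \<epsilon>) * d"
  have \<kappa>: "\<kappa> > 0" using d \<epsilon> by (simp add: \<kappa>_def)
  obtain k where holk: "k holomorphic_on ball 0 1" and gk: "\<And>w. cmod w < 1 \<Longrightarrow> g w = w * k w"
    and k0: "deriv g 0 = k 0"
    using Schwarz3[OF holg g0] by blast
  have low': "(1 + (cmod w)^2 / \<kappa>)^d \<le> (cmod (\<beta> w))^2 * (1 + (cmod (w * k w))^2)" if "cmod w < 1" for w
    using low[OF that] gk[OF that] by (simp add: \<kappa>_def)
  have lip: "cmod (g w) \<le> C * cmod w"
    if C: "\<And>w. cmod w < R \<Longrightarrow> 1 + (cmod (g w))^2 \<le> C" and w: "cmod w < R" for C w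
  proof -
    have "cmod (g w - g 0) \<le> C * cmod (w - 0)"
    proof (rule field_differentiable_bound[where S = "ball 0 R" and f' = "deriv g"])
      fix z :: complex assume z: "z \<in> ball 0 R"
      then have z1: "cmod z < 1" "cmod z < R" by (auto simp: R_def)
      show "(g has_field_derivative deriv g z) (at z within ball 0 R)"
        using holomorphic_derivI[OF holg, of z] z1 by (simp add: has_field_derivative_at_within)
      show "cmod (deriv g z) \<le> C" using dg[OF z1(1)] C[OF z1(2)] by linarith
    qed (use w in \<open>auto simp: R_def\<close>)
    then show ?thesis by (simp add: g0)
  qed
  \<comment> \<open>A first, crude bound for \<open>g\<close>; feeding it back into the derivative bound improves it to second order.\<close>
  have c1: "1 + (cmod (g w))^2 \<le> 2" if "cmod w < R" for w
  proof -
    have "cmod w < 1" using that by (simp add: R_def)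
    have "1/2 * (1 + (cmod (g w))^2) \<le> (1 - cmod w) * (1 + (cmod (g w))^2)"
      using that by (intro mult_right_mono) (auto simp: R_def)
    also have "\<dots> \<le> 1" by (rule prox) fact
    finally show ?thesis by simp
  qed
  have c2: "1 + (cmod (g w))^2 \<le> 1 + 4 * R^2" if "cmod w < R" for w
  proof -
    have "cmod (g w) \<le> 2 * R" using lip[OF c1 that] that by linarith
    then have "(cmod (g w))^2 \<le> (2 * R)^2" by (intro power_mono) auto
    then show ?thesis by (simp add: power_mult_distrib)
  qed
  have b1: "cmod (k 0) \<le> 1" using dg[of 0] by (simp add: k0 g0)
  have kM: "cmod (k w) < M" if "cmod w < R" for w
  proof (cases "w = 0")
    case True
    then show ?thesis using b1 by (simp add: M_def R_def power_divide)
  next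
    case False
    have "cmod w * cmod (k w) \<le> cmod w * (1 + 4 * R^2)"
      using lip[OF c2 that] gk[of w] that by (simp add: R_def norm_mult mult.commute)
    then have "cmod (k w) \<le> 1 + 4 * R^2" using False by simp
    also have "\<dots> < M" by (simp add: M_def R_def)
    finally show ?thesis .
  qed
  have blow: "d / \<kappa> \<le> (cmod (k 0))^2"
    by (rule center_derivative_lower_bound[OF holk hol\<beta> nz \<beta>0 \<kappa> low'])
  have dk: "d / \<kappa> = 1 / (1 + \<epsilon>)" using d by (simp add: \<kappa>_def)
  have bsq: "(cmod (k 0))^2 \<ge> 1 - \<epsilon>" using blow unfolding dk \<epsilon> by simp
  have b_ge: "cmod (k 0) \<ge> 1 - \<epsilon>"
  proof -
    have "(cmod (k 0))^2 \<le> cmod (k 0) * 1" unfolding power2_eq_square using b1 by (intro mult_left_mono) auto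
    then show ?thesis using bsq by linarith
  qed
  obtain w where w: "cmod w = \<rho>" and ineq: "d / \<kappa> - d * \<rho>^2 / (2 * \<kappa>^2) \<le>
       (cmod (k 0))^2 + (cmod (k w - k 0))^2 - \<rho>^2 * cmod (k w)^4 / 2 + \<rho>^4 * cmod (k w)^6 / 3"
    by (rule circle_inequality[OF holk hol\<beta> nz \<beta>0 _ _ \<kappa> low', of \<rho>]) (simp_all add: \<rho>_def)
  have "M * cmod (k w - k 0) \<le> 2 * (cmod w / R) * (M^2 - (cmod (k 0))^2)"
  proof (rule schwarz_pick_at_center[OF _ kM])
    show "k holomorphic_on ball 0 R" by (rule holomorphic_on_subset[OF holk]) (auto simp: R_def)
  qed (auto simp: w \<rho>_def R_def)
  also have "\<dots> = M^2 - (cmod (k 0))^2" by (simp add: w \<rho>_def R_def)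
  also have "\<dots> \<le> M^2 - 1 + \<epsilon>" using bsq by linarith
  also have "\<dots> \<le> M * (\<rho> / 9)" by (simp add: M_def R_def \<epsilon> \<rho>_def power2_eq_square)
  finally have kb: "cmod (k w - k 0) \<le> \<rho> / 9"
    by (rule mult_left_le_imp_le) (simp add: M_def R_def power_divide)
  have kb2: "(cmod (k w - k 0))^2 \<le> (\<rho> / 9)^2" using kb by (intro power_mono) auto
  have "cmod (k 0) \<le> cmod (k w) + cmod (k w - k 0)" by (metis norm_minus_commute norm_triangle_sub)
  then have "cmod (k w) \<ge> 99/100" using kb b_ge by (simp add: \<rho>_def \<epsilon>)
  then have k4: "cmod (k w)^4 \<ge> (99/100)^4" by (intro power_mono) auto
  have "cmod (k w) \<le> 101/100" using kM[of w] by (simp add: w M_def R_def \<rho>_def power_divide)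
  then have k6: "cmod (k w)^6 \<le> (101/100)^6" by (intro power_mono) auto
  have b1sq: "(cmod (k 0))^2 \<le> 1" using b1 by (simp add: power_le_one)
  \<comment> \<open>The curvature of the source; this is the step that needs \<open>d \<ge> 2\<close>.\<close>
  have "d * \<rho>^2 / (2 * \<kappa>^2) = \<rho>^2 / (2 * (1 + \<epsilon>)^2 * d)"
  proof -
    have "2 * \<kappa>^2 = (2 * (1 + \<epsilon>)^2 * d) * d" by (simp add: \<kappa>_def power2_eq_square)
    then show ?thesis using d by simp
  qed
  also have "\<dots> \<le> \<rho>^2 / 4"
  proof (rule divide_left_mono)
    have "1 * 2 \<le> (1 + \<epsilon>)^2 * real d"
      using d by (intro mult_mono) (auto simp: \<epsilon>)
    then show "4 \<le> 2 * (1 + \<epsilon>)^2 * d" by (simp add: mult_ac)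
    show "0 < 2 * (1 + \<epsilon>)^2 * real d * 4" using d by (simp add: \<epsilon>)
  qed simp
  finally have curv: "d * \<rho>^2 / (2 * \<kappa>^2) \<le> \<rho>^2 / 4" .
  have "\<rho>^2 * (99/100)^4 \<le> \<rho>^2 * cmod (k w)^4" using k4 by (intro mult_left_mono) auto
  moreover have "\<rho>^4 * cmod (k w)^6 \<le> \<rho>^4 * (101/100)^6" using k6 by (intro mult_left_mono) auto
  ultimately have "1 / (1 + \<epsilon>) - \<rho>^2 / 4 \<le>
       1 + (\<rho> / 9)^2 - \<rho>^2 * (99/100)^4 / 2 + \<rho>^4 * (101/100)^6 / 3"
    using ineq curv b1sq kb2 unfolding dk by linarith
  then show False by (simp add: \<rho>_def \<epsilon> power_divide)
qed

section \<open>The lower bound\<close>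

text \<open>
  If the bound failed, \<open>K f\<close> could be replaced by the larger number \<open>M\<close> with \<open>M\<^sup>2 = (1 + \<epsilon>) * d\<close>
  exactly, and rescaling the normalized pair by \<open>M\<close> would give an almost isometric disc.
\<close>
lemma K_lower_bound:
  assumes cop: "coprime p q" and d: "d = max (degree p) (degree q)" "d \<ge> 2"
    and f: "\<And>z. f (Some z) = (if poly q z = 0 then None else Some (poly p z / poly q z))"
  shows "sqrt (1 + 1 / 16000000) * sqrt d \<le> K f"
proof (rule ccontr)
  assume small: "\<not> ?thesis"
  define \<epsilon> :: real where "\<epsilon> = 1 / 16000000"
  define M where "M = sqrt ((1 + \<epsilon>) * d)"
  have d1: "d \<ge> 1" using d by simp
  have M: "M > 0" "M^2 = (1 + \<epsilon>) * d" using d by (simp_all add: M_def \<epsilon>_def)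
  have KM: "K f \<le> M" using small unfolding M_def \<epsilon>_def real_sqrt_mult by linarith
  have "pair_deriv (poly p) (poly q) z \<le> M" for z
    using spherical_deriv_le_K[OF cop d(1) d1 f, of "Some z"] KM
    by (simp add: spherical_deriv_eq(1)[OF cop d(1) d1 f])
  then obtain A B where hol: "A holomorphic_on UNIV" "B holomorphic_on UNIV" and AB0: "A 0 = 0" "B 0 = 1"
    and low: "\<And>w. (1 + (cmod w)^2)^d \<le> (cmod (A w))^2 + (cmod (B w))^2"
    and up: "\<And>w. pair_deriv A B w \<le> M"
    using normalized_pair[OF cop d(1) d1] by metis
  have pos: "(cmod (A w))^2 + (cmod (B w))^2 > 0" for w
  proof -
    have "0 < (1 + (cmod w)^2)^d" by (simp add: add_pos_nonneg)
    then show ?thesis using low[of w] by linarith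
  qed
  have W: "cmod (deriv A w * B w - A w * deriv B w) * (1 + (cmod w)^2)
      \<le> M * ((cmod (A w))^2 + (cmod (B w))^2)" for w
    using up[of w] pos[of w] by (simp add: pair_deriv_def pos_divide_le_eq)
  define \<beta> where "\<beta> w = B (w / of_real M)" for w
  define \<alpha> where "\<alpha> w = A (w / of_real M)" for w
  define g where "g w = \<alpha> w / \<beta> w" for w
  have prox: "(1 - cmod w) * ((cmod (\<alpha> w))^2 + (cmod (\<beta> w))^2) \<le> (cmod (\<beta> w))^2" for w
    using proximity_bound[OF hol AB0 pos W, of "w / of_real M"] M by (simp add: \<alpha>_def \<beta>_def norm_divide)
  have nz: "\<beta> w \<noteq> 0" if "cmod w < 1" for w
  proof -
    have "0 < (1 - cmod w) * ((cmod (\<alpha> w))^2 + (cmod (\<beta> w))^2)"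
      using that pos by (simp add: \<alpha>_def \<beta>_def)
    then show ?thesis using prox[of w] by auto
  qed
  have split: "(cmod (\<alpha> w))^2 + (cmod (\<beta> w))^2 = (cmod (\<beta> w))^2 * (1 + (cmod (g w))^2)" if "cmod w < 1" for w
    using nz[OF that] by (simp add: g_def norm_divide power_divide distrib_left)
  have "(\<lambda>w. h (w / of_real M)) holomorphic_on ball 0 1" if "h holomorphic_on UNIV" for h
    using M by (intro holomorphic_on_compose_gen[OF _ that, unfolded o_def]) (auto intro!: holomorphic_intros)
  then have hol\<alpha>: "\<alpha> holomorphic_on ball 0 1" and hol\<beta>: "\<beta> holomorphic_on ball 0 1"
    unfolding \<alpha>_def \<beta>_def using hol by blast+
  have holg: "g holomorphic_on ball 0 1"
    unfolding g_def using nz by (intro holomorphic_intros hol\<alpha> hol\<beta>) auto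
  show False
  proof (rule no_almost_isometric_disc[OF holg hol\<beta> nz _ _ _ _ d(2) \<epsilon>_def])
    show "\<beta> 0 = 1" "g 0 = 0" by (simp_all add: \<beta>_def g_def \<alpha>_def AB0)
  next
    fix w :: complex assume w: "cmod w < 1"
    have \<beta>: "(cmod (\<beta> w))^2 > 0" using nz[OF w] by simp
    show "(1 - cmod w) * (1 + (cmod (g w))^2) \<le> 1"
      using prox[of w] \<beta> unfolding split[OF w] by simp
    show "(1 + (cmod w)^2 / ((1 + \<epsilon>) * d))^d \<le> (cmod (\<beta> w))^2 * (1 + (cmod (g w))^2)"
      using low[of "w / of_real M"] M unfolding split[OF w, symmetric]
      by (simp add: \<alpha>_def \<beta>_def norm_divide power_divide)
    define z where "z = w / of_real M"
    have "(A has_field_derivative deriv A z) (at z)" "(B has_field_derivative deriv B z) (at z)"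
      using hol by (auto intro!: holomorphic_derivI)
    then have "(g has_field_derivative
        (deriv A z * B z - A z * deriv B z) / (B z * B z) / of_real M) (at w)"
      unfolding g_def \<alpha>_def \<beta>_def z_def using nz[OF w] M
      by (auto intro!: derivative_eq_intros DERIV_chain2[of A] DERIV_chain2[of B] simp: \<beta>_def field_simps)
    then have "deriv g w = (deriv A z * B z - A z * deriv B z) / (B z * B z) / of_real M"
      by (rule DERIV_imp_deriv)
    then have "cmod (deriv g w) = cmod (deriv A z * B z - A z * deriv B z) / (cmod (\<beta> w))^2 / M"
      using M by (simp add: norm_divide norm_mult z_def \<beta>_def power2_eq_square)
    also have "\<dots> \<le> M * ((cmod (A z))^2 + (cmod (B z))^2) / (cmod (\<beta> w))^2 / M"
    proof (intro divide_right_mono)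
      have "cmod (deriv A z * B z - A z * deriv B z)
          \<le> cmod (deriv A z * B z - A z * deriv B z) * (1 + (cmod z)^2)"
        by (simp add: mult_le_cancel_left1)
      also note W
      finally show "cmod (deriv A z * B z - A z * deriv B z) \<le> M * ((cmod (A z))^2 + (cmod (B z))^2)" .
    qed (use M in auto)
    also have "(cmod (A z))^2 + (cmod (B z))^2 = (cmod (\<beta> w))^2 * (1 + (cmod (g w))^2)"
      using split[OF w] by (simp add: \<alpha>_def \<beta>_def z_def)
    also have "M * ((cmod (\<beta> w))^2 * (1 + (cmod (g w))^2)) / (cmod (\<beta> w))^2 / M = 1 + (cmod (g w))^2"
      using M \<beta> by simp
    finally show "cmod (deriv g w) \<le> 1 + (cmod (g w))^2" .
  qed
qed

theorem theorem2:
  shows "\<exists>c::real. c > 1 \<and>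
    (\<forall>(d::nat) (f :: sphere \<Rightarrow> sphere).
       d \<ge> 2 \<longrightarrow> rational_function f \<longrightarrow> has_degree f d \<longrightarrow> K f \<ge> c * sqrt (real d))"
proof (intro exI conjI allI impI)
  show "sqrt (1 + 1 / 16000000) > (1::real)" by simp
  fix d :: nat and f :: "sphere \<Rightarrow> sphere"
  assume d: "d \<ge> 2" and "has_degree f d"
  then obtain p q where "coprime p q" "d = max (degree p) (degree q)"
    "\<And>z. f (Some z) = (if poly q z = 0 then None else Some (poly p z / poly q z))"
    unfolding has_degree_def by blast
  then show "sqrt (1 + 1 / 16000000) * sqrt d \<le> K f" using d by (intro K_lower_bound)
qed

end
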